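(* Let $k$ and $\delta$ be positive integers with $2\le k<\sqrt{\ln\delta}$, and let $G$ be a connected graph on $n\ge k$ vertices with minimum degree at least $\delta$. Then $rx_k(G)\leq n\frac{\ln\delta}{\delta}(1+o_\delta(1))$, where $o_\delta(1)$ denotes a quantity depending only on $\delta$ that tends to $0$ as $\delta\to\infty$.
   Context: All graphs are simple, finite and undirected. For an edge-coloring of a connected graph $G$ (adjacent edges may receive the same color), a tree in $G$ is a rainbow tree if no two of its edges receive the same color. For an integer $k$ with $2\leq k\leq n=|V(G)|$, an edge-coloring is a $k$-rainbow coloring if for every set $S$ of $k$ vertices of $G$ there is a rainbow tree in $G$ containing all vertices of $S$. The $k$-rainbow index $rx_k(G)$ is the minimum number of colors in a $k$-rainbow coloring of $G$. *)

theory Defs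
  imports Complex_Main
begin

(* A graph is given by its vertex set V and its edge set E, an edge being the
   two-element set of its end vertices. *)

definition simple_graph :: "'a set \<Rightarrow> 'a set set \<Rightarrow> bool" where
  "simple_graph V E \<longleftrightarrow> finite V \<and> (\<forall>e\<in>E. e \<subseteq> V \<and> card e = 2)"

definition graph_walk :: "'a set \<Rightarrow> 'a set set \<Rightarrow> 'a list \<Rightarrow> bool" where
  "graph_walk V E p \<longleftrightarrow>
     p \<noteq> [] \<and> set p \<subseteq> V \<and> (\<forall>i. Suc i < length p \<longrightarrow> {p ! i, p ! Suc i} \<in> E)"

definition graph_connected :: "'a set \<Rightarrow> 'a set set \<Rightarrow> bool" where
  "graph_connected V E \<longleftrightarrow>
     V \<noteq> {} \<and> (\<forall>u\<in>V. \<forall>v\<in>V. \<exists>p. graph_walk V E p \<and> hd p = u \<and> last p = v)"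

(* The first vertex of a cycle is not repeated at the end of the list. *)
definition graph_cycle :: "'a set \<Rightarrow> 'a set set \<Rightarrow> 'a list \<Rightarrow> bool" where
  "graph_cycle V E p \<longleftrightarrow>
     graph_walk V E p \<and> distinct p \<and> 3 \<le> length p \<and> {last p, hd p} \<in> E"

definition graph_tree :: "'a set \<Rightarrow> 'a set set \<Rightarrow> bool" where
  "graph_tree V E \<longleftrightarrow>
     simple_graph V E \<and> graph_connected V E \<and> (\<nexists>p. graph_cycle V E p)"

definition vertex_degree :: "'a set set \<Rightarrow> 'a \<Rightarrow> nat" where
  "vertex_degree E v = card {e \<in> E. v \<in> e}"

definition min_degree :: "'a set \<Rightarrow> 'a set set \<Rightarrow> nat" where
  "min_degree V E = Min (vertex_degree E ` V)"

definition rainbow_tree ::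
  "'a set \<Rightarrow> 'a set set \<Rightarrow> ('a set \<Rightarrow> nat) \<Rightarrow> 'a set \<Rightarrow> 'a set set \<Rightarrow> bool" where
  "rainbow_tree V E c W F \<longleftrightarrow>
     W \<subseteq> V \<and> F \<subseteq> E \<and> graph_tree W F \<and> inj_on c F"

definition k_rainbow_coloring ::
  "nat \<Rightarrow> 'a set \<Rightarrow> 'a set set \<Rightarrow> ('a set \<Rightarrow> nat) \<Rightarrow> bool" where
  "k_rainbow_coloring k V E c \<longleftrightarrow>
     (\<forall>S. S \<subseteq> V \<and> card S = k \<longrightarrow> (\<exists>W F. rainbow_tree V E c W F \<and> S \<subseteq> W))"

(* Only the values of a coloring on E matter. The minimum exists whenever the
   graph is connected: color all edges differently. *)
definition rainbow_index :: "nat \<Rightarrow> 'a set \<Rightarrow> 'a set set \<Rightarrow> nat" where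
  "rainbow_index k V E = (LEAST m. \<exists>c. k_rainbow_coloring k V E c \<and> card (c ` E) = m)"

end

theory Submission
  imports Defs "HOL-Real_Asymp.Real_Asymp"
begin

text \<open>
  If every vertex outside a connected set \<open>D\<close> has at least \<open>k\<close> neighbours in \<open>D\<close>, then
  \<open>card D + k\<close> colors suffice. Let \<open>L = ln \<delta>\<close> and \<open>s = sqrt L\<close>. To find a small \<open>D\<close>, choose vertices
  independently with probability \<open>(L + s ln L) / \<delta>\<close> to form \<open>X\<close>, and let \<open>Y\<close> be the set of all
  vertices with fewer than \<open>s\<close> neighbours in \<open>X\<close>; the expected size of \<open>Y\<close> is \<open>O(n / \<delta>)\<close>.
  A component of the graph induced on \<open>X \<union> Y\<close> either has more than \<open>s\<close> vertices or lies inside \<open>Y\<close>,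
  so there are few components, and since the set is dominating, each additional component is joined
  at the cost of two more vertices.
\<close>

subsection \<open>Trees\<close>

lemma graph_walk_successively:
  "graph_walk V E p \<longleftrightarrow> p \<noteq> [] \<and> set p \<subseteq> V \<and> successively (\<lambda>a b. {a, b} \<in> E) p"
  unfolding graph_walk_def successively_conv_nth by auto

lemma graph_walk_mono:
  assumes "graph_walk V E p" "V \<subseteq> V'" "E \<subseteq> E'"
  shows "graph_walk V' E' p"
  using assms unfolding graph_walk_def by blast

lemma graph_tree_singleton: "graph_tree {v} {}"
proof -
  have "graph_walk {v} {} [v]"
    by (simp add: graph_walk_def)
  then have "graph_connected {v} {}"
    unfolding graph_connected_def by (auto intro!: exI[of _ "[v]"])
  then show ?thesis
    by (auto simp: graph_tree_def simple_graph_def graph_cycle_def)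
qed

text \<open>A vertex on a cycle has neighbours at two different positions of the list; for a vertex
  adjacent to \<open>d\<close> alone, \<open>d\<close> would stand at both, against
  \<open>distinct p\<close>.\<close>

lemma graph_cycle_leaf:
  assumes "graph_cycle V E p" and leaf: "\<And>u. {v, u} \<in> E \<Longrightarrow> u = d"
  shows "v \<notin> set p"
proof
  assume "v \<in> set p"
  then obtain i where i: "i < length p" "p ! i = v"
    by (auto simp: in_set_conv_nth)
  have dist: "distinct p" and len: "3 \<le> length p" and lh: "{last p, hd p} \<in> E"
    and step: "\<And>i. Suc i < length p \<Longrightarrow> {p ! i, p ! Suc i} \<in> E"
    using assms(1) by (auto simp: graph_cycle_def graph_walk_def)
  have last: "last p = p ! (length p - 1)" and hd: "hd p = p ! 0"
    using len by (metis last_conv_nth list.size(3) not_numeral_le_zero, metis hd_conv_nth list.size(3) not_numeral_le_zero)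
  \<comment> \<open>The cyclic predecessor and successor of position \<open>i\<close>; at either end
    of the list, length at least 3 keeps them apart.\<close>
  have "\<exists>a b. a < length p \<and> b < length p \<and> a \<noteq> b \<and> {v, p ! a} \<in> E \<and> {v, p ! b} \<in> E"
  proof -
    consider "i = 0" | "i = length p - 1" "i > 0" | "i > 0" "Suc i < length p"
      using i by linarith
    then show ?thesis
    proof cases
      case 1
      then show ?thesis
        using step[of 0] lh len i last hd
        by (intro exI[of _ 1] exI[of _ "length p - 1"]) (auto simp: insert_commute)
    next
      case 2
      then show ?thesis
        using step[of "i - 1"] lh len i last hd
        by (intro exI[of _ "i - 1"] exI[of _ 0]) (auto simp: insert_commute Suc_diff_Suc numeral_2_eq_2)
    next
      case 3
      then show ?thesis
        using step[of "i - 1"] step[of i] i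
        by (intro exI[of _ "i - 1"] exI[of _ "Suc i"]) (auto simp: insert_commute)
    qed
  qed
  then obtain a b where "a < length p" "b < length p" "a \<noteq> b" "p ! a = d" "p ! b = d"
    using leaf by blast
  then show False
    using dist nth_eq_iff_index_eq by metis
qed

text \<open>Walks reach \<open>v\<close> by one extra step through \<open>d\<close>. By
  \<open>graph_cycle_leaf\<close> a cycle avoids \<open>v\<close>, hence the new edge, and would
  already lie in the old tree.\<close>

lemma graph_tree_add_leaf:
  assumes tree: "graph_tree W F" and "d \<in> W" "v \<notin> W"
  shows "graph_tree (insert v W) (insert {v, d} F)"
proof -
  have sg: "simple_graph W F" and con: "graph_connected W F" and acyc: "\<nexists>p. graph_cycle W F p"
    using tree by (auto simp: graph_tree_def)
  have FW: "e \<subseteq> W" if "e \<in> F" for e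
    using sg that by (auto simp: simple_graph_def)
  have "v \<noteq> d"
    using assms by auto
  then have "simple_graph (insert v W) (insert {v, d} F)"
    using sg \<open>d \<in> W\<close> by (auto simp: simple_graph_def)
  moreover have "graph_connected (insert v W) (insert {v, d} F)"
    unfolding graph_connected_def
  proof (intro conjI ballI)
    fix u w assume uw: "u \<in> insert v W" "w \<in> insert v W"
    have walk: "\<exists>p. graph_walk (insert v W) (insert {v, d} F) p \<and> hd p = x \<and> last p = y"
      if "x \<in> W" "y \<in> W" for x y
      using con that graph_walk_mono unfolding graph_connected_def by (metis subset_insertI)
    consider "u \<in> W" "w \<in> W" | "u = v" "w \<in> W" | "u \<in> W" "w = v" | "u = v" "w = v"
      using uw by auto
    then show "\<exists>p. graph_walk (insert v W) (insert {v, d} F) p \<and> hd p = u \<and> last p = w"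
    proof cases
      case 1
      then show ?thesis by (rule walk)
    next
      case 2
      obtain p where "graph_walk (insert v W) (insert {v, d} F) p" "hd p = d" "last p = w"
        using walk[OF \<open>d \<in> W\<close> \<open>w \<in> W\<close>] by auto
      then show ?thesis
        using 2 by (intro exI[of _ "v # p"]) (auto simp: graph_walk_successively successively_Cons)
    next
      case 3
      obtain p where "graph_walk (insert v W) (insert {v, d} F) p" "hd p = u" "last p = d"
        using walk[OF \<open>u \<in> W\<close> \<open>d \<in> W\<close>] by auto
      then show ?thesis
        using 3 by (intro exI[of _ "p @ [v]"])
          (auto simp: graph_walk_successively successively_append_iff insert_commute)
    next
      case 4
      then show ?thesis
        by (intro exI[of _ "[v]"]) (auto simp: graph_walk_successively)
    qed
  qed simp
  moreover have "\<not> graph_cycle (insert v W) (insert {v, d} F) p" for p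
  proof
    assume cyc: "graph_cycle (insert v W) (insert {v, d} F) p"
    have v: "v \<notin> set p"
      using cyc
    proof (rule graph_cycle_leaf)
      fix u assume "{v, u} \<in> insert {v, d} F"
      then show "u = d"
        using FW \<open>v \<notin> W\<close> by (auto simp: doubleton_eq_iff)
    qed
    have len: "3 \<le> length p"
      using cyc by (simp add: graph_cycle_def)
    then have "p \<noteq> []" by auto
    then have "{last p, hd p} \<noteq> {v, d}"
      using v by (metis doubleton_eq_iff hd_in_set last_in_set)
    moreover have "{p ! i, p ! Suc i} \<noteq> {v, d}" if "Suc i < length p" for i
      using v that by (metis Suc_lessD doubleton_eq_iff nth_mem)
    ultimately have "graph_cycle W F p"
      using cyc v unfolding graph_cycle_def graph_walk_def by auto
    then show False
      using acyc by blast
  qed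
  ultimately show ?thesis
    by (auto simp: graph_tree_def)
qed

lemma graph_tree_add_leaves:
  assumes "finite T" "graph_tree D F" "T \<inter> D = {}" "\<And>v. v \<in> T \<Longrightarrow> f v \<in> D"
  shows "graph_tree (D \<union> T) (F \<union> (\<lambda>v. {v, f v}) ` T)"
  using assms
proof (induction T rule: finite_induct)
  case (insert v T)
  have "graph_tree (insert v (D \<union> T)) (insert {v, f v} (F \<union> (\<lambda>v. {v, f v}) ` T))"
    using insert by (intro graph_tree_add_leaf) auto
  then show ?case
    by simp
qed simp

subsection \<open>Connected vertex sets\<close>

text \<open>Connectedness of the subgraph induced on \<open>D\<close>, expressed through cuts: this form is closed under
  unions of overlapping sets and yields spanning trees by growing.\<close>

definition cut_connected :: "'a set set \<Rightarrow> 'a set \<Rightarrow> bool" where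
  "cut_connected E D \<longleftrightarrow>
     D \<noteq> {} \<and> (\<forall>A. A \<subseteq> D \<and> A \<noteq> {} \<and> A \<noteq> D \<longrightarrow> (\<exists>a\<in>A. \<exists>b\<in>D - A. {a, b} \<in> E))"

lemma cut_connected_crossing:
  assumes "cut_connected E D" "A \<subseteq> D" "A \<noteq> {}" "A \<noteq> D"
  obtains a b where "a \<in> A" "b \<in> D - A" "{a, b} \<in> E"
  using assms unfolding cut_connected_def by blast

text \<open>A walk from inside \<open>A\<close> to outside has a step leaving \<open>A\<close>;
  induction on the walk finds it.\<close>

lemma graph_connected_imp_cut_connected:
  assumes "graph_connected V E"
  shows "cut_connected E V"
  unfolding cut_connected_def
proof (intro conjI allI impI)
  show "V \<noteq> {}"
    using assms by (simp add: graph_connected_def)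
next
  fix A assume A: "A \<subseteq> V \<and> A \<noteq> {} \<and> A \<noteq> V"
  then obtain u w where uw: "u \<in> A" "w \<in> V" "w \<notin> A"
    by auto
  then obtain p where p: "graph_walk V E p" "hd p = u" "last p = w"
    using assms A unfolding graph_connected_def by blast
  have "\<exists>a\<in>A. \<exists>b\<in>V - A. {a, b} \<in> E"
    if "p \<noteq> []" "set p \<subseteq> V" "successively (\<lambda>a b. {a, b} \<in> E) p" "hd p \<in> A" "last p \<notin> A" for p
    using that
  proof (induction p)
    case (Cons x p)
    show ?case
    proof (cases "p = []")
      case False
      have edge: "{x, hd p} \<in> E" and rest: "successively (\<lambda>a b. {a, b} \<in> E) p"
        using False Cons.prems by (auto simp: successively_Cons)
      have "hd p \<in> V"
        using False Cons.prems by auto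
      show ?thesis
      proof (cases "hd p \<in> A")
        case True
        then show ?thesis
          using Cons.IH Cons.prems False rest by auto
      next
        case notA: False
        show ?thesis
          using edge notA \<open>hd p \<in> V\<close> Cons.prems(4) by (intro bexI[of _ x] bexI[of _ "hd p"]) auto
      qed
    qed (use Cons in auto)
  qed simp
  then show "\<exists>a\<in>A. \<exists>b\<in>V - A. {a, b} \<in> E"
    using p uw unfolding graph_walk_successively by blast
qed

lemma cut_connected_singleton: "cut_connected E {v}"
  unfolding cut_connected_def by auto

lemma cut_connected_edge:
  assumes "{a, b} \<in> E"
  shows "cut_connected E {a, b}"
  unfolding cut_connected_def
proof (intro conjI allI impI)
  fix A assume "A \<subseteq> {a, b} \<and> A \<noteq> {} \<and> A \<noteq> {a, b}"
  then have "A = {a} \<and> a \<noteq> b \<or> A = {b} \<and> a \<noteq> b"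
    by blast
  then show "\<exists>x\<in>A. \<exists>y\<in>{a, b} - A. {x, y} \<in> E"
    using assms by (auto simp: insert_commute)
qed simp

text \<open>If a cut \<open>Z\<close> split neither \<open>A\<close> nor \<open>B\<close>, each
  would lie wholly inside or outside \<open>Z\<close>; a common vertex puts both on the same side,
  so \<open>Z\<close> would be empty or everything.\<close>

lemma cut_connected_Un:
  assumes A: "cut_connected E A" and B: "cut_connected E B" and "A \<inter> B \<noteq> {}"
  shows "cut_connected E (A \<union> B)"
  unfolding cut_connected_def
proof (intro conjI allI impI)
  show "A \<union> B \<noteq> {}"
    using assms by auto
next
  fix Z assume Z: "Z \<subseteq> A \<union> B \<and> Z \<noteq> {} \<and> Z \<noteq> A \<union> B"
  consider "Z \<inter> A \<noteq> {}" "Z \<inter> A \<noteq> A" | "Z \<inter> B \<noteq> {}" "Z \<inter> B \<noteq> B"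
    using Z \<open>A \<inter> B \<noteq> {}\<close> by blast
  then show "\<exists>a\<in>Z. \<exists>b\<in>A \<union> B - Z. {a, b} \<in> E"
  proof cases
    case 1
    then show ?thesis
      using cut_connected_crossing[OF A, of "Z \<inter> A"] by blast
  next
    case 2
    then show ?thesis
      using cut_connected_crossing[OF B, of "Z \<inter> B"] by blast
  qed
qed

lemma cut_connected_insert:
  assumes "cut_connected E A" "a \<in> A" "{a, b} \<in> E"
  shows "cut_connected E (insert b A)"
proof -
  have "cut_connected E (A \<union> {a, b})"
    using assms by (intro cut_connected_Un cut_connected_edge) auto
  moreover have "A \<union> {a, b} = insert b A"
    using assms by auto
  ultimately show ?thesis
    by simp
qed

text \<open>For \<open>v \<in> D\<close> this concerns the component of \<open>v\<close> in the
  subgraph induced on \<open>D\<close>. A set containing \<open>v\<close> that no step of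
  \<open>r\<close> leaves contains everything reachable; a cut missing \<open>v\<close> is treated
  through its complement.\<close>

lemma cut_connected_reachable:
  fixes E :: "'a set set" and D :: "'a set"
  defines "r \<equiv> {(a, b). a \<in> D \<and> b \<in> D \<and> {a, b} \<in> E}"
  shows "cut_connected E (r\<^sup>* `` {v})"
  unfolding cut_connected_def
proof (intro conjI allI impI)
  fix A assume A: "A \<subseteq> r\<^sup>* `` {v} \<and> A \<noteq> {} \<and> A \<noteq> r\<^sup>* `` {v}"
  have exit: "\<exists>a\<in>B. \<exists>b. b \<notin> B \<and> (v, b) \<in> r\<^sup>* \<and> (a, b) \<in> r"
    if "v \<in> B" "\<not> r\<^sup>* `` {v} \<subseteq> B" for B
  proof (rule ccontr)
    assume no: "\<not> ?thesis"
    have "x \<in> B" if "(v, x) \<in> r\<^sup>*" for x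
      using that
    proof (induction rule: rtrancl_induct)
      case (step y z)
      then show ?case
        using no rtrancl.rtrancl_into_rtrancl by metis
    qed (fact \<open>v \<in> B\<close>)
    then show False
      using that by auto
  qed
  show "\<exists>a\<in>A. \<exists>b\<in>r\<^sup>* `` {v} - A. {a, b} \<in> E"
  proof (cases "v \<in> A")
    case True
    then show ?thesis
      using exit[of A] A by (auto simp: r_def)
  next
    case False
    then obtain a b where "a \<in> r\<^sup>* `` {v} - A" "b \<in> r\<^sup>* `` {v}" "b \<in> A" "(a, b) \<in> r"
      using exit[of "r\<^sup>* `` {v} - A"] A by auto
    then show ?thesis
      by (intro bexI[of _ b] bexI[of _ a]) (auto simp: r_def insert_commute)
  qed
qed auto

text \<open>Prim-style growth: while the tree misses part of \<open>D\<close>, some edge leaves its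
  vertex set and adds a leaf.\<close>

lemma cut_connected_spanning_tree:
  assumes "finite D" and D: "cut_connected E D"
  obtains F where "graph_tree D F" "F \<subseteq> E" "card F < card D"
proof -
  have grow: "\<exists>W F. W \<subseteq> D \<and> F \<subseteq> E \<and> graph_tree W F \<and> card W = Suc m \<and> card F \<le> m"
    if "m < card D" for m
    using that
  proof (induction m)
    case 0
    then obtain v where "v \<in> D"
      using D by (auto simp: cut_connected_def)
    then show ?case
      by (intro exI[of _ "{v}"] exI[of _ "{}"]) (auto simp: graph_tree_singleton)
  next
    case (Suc m)
    then obtain W F where WF: "W \<subseteq> D" "F \<subseteq> E" "graph_tree W F" "card W = Suc m" "card F \<le> m"
      by auto
    then have "W \<noteq> {}" "W \<noteq> D"
      using Suc.prems by auto
    then obtain a b where ab: "a \<in> W" "b \<in> D - W" "{a, b} \<in> E"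
      using cut_connected_crossing[OF D \<open>W \<subseteq> D\<close>] by blast
    have "finite W"
      using WF assms finite_subset by blast
    then have "card (insert b W) = Suc (Suc m)"
      using ab WF by auto
    moreover have "card (insert {b, a} F) \<le> Suc m"
      using WF card_insert_le_m1[of "Suc m" F] by simp
    moreover have "graph_tree (insert b W) (insert {b, a} F)"
      using graph_tree_add_leaf[OF WF(3)] ab by auto
    moreover have "insert b W \<subseteq> D" "insert {b, a} F \<subseteq> E"
      using ab WF by (auto simp: insert_commute)
    ultimately show ?case
      by blast
  qed
  have "card D > 0"
    using assms by (auto simp: cut_connected_def card_gt_0_iff)
  then obtain W F where WF: "W \<subseteq> D" "F \<subseteq> E" "graph_tree W F" "card W = card D" "card F \<le> card D - 1"
    using grow[of "card D - 1"] by auto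
  have "W = D"
    by (rule card_subset_eq[OF \<open>finite D\<close> WF(1,4)])
  then show ?thesis
    using that[of F] WF \<open>card D > 0\<close> by auto
qed

subsection \<open>Joining the pieces of a dominating set\<close>

text \<open>Let \<open>N\<close> be the neighbours of \<open>A\<close>. Either
  \<open>A \<union> N\<close> meets another piece, or an edge \<open>{x, y}\<close> leaves
  \<open>A \<union> N\<close>; then \<open>x\<close> is adjacent to \<open>A\<close>, and domination
  puts \<open>y\<close> in or next to another piece, so \<open>x\<close> and \<open>y\<close>
  suffice as connectors.\<close>

lemma join_two_pieces:
  assumes V: "cut_connected E V" and P: "finite P" "1 < card P"
    and piece: "\<And>A. A \<in> P \<Longrightarrow> cut_connected E A \<and> A \<subseteq> V"
    and dom: "\<And>v. v \<in> V - \<Union>P \<Longrightarrow> \<exists>u\<in>\<Union>P. {v, u} \<in> E"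
  obtains A B X where "A \<in> P" "B \<in> P" "A \<noteq> B" "finite X" "card X \<le> 2" "X \<subseteq> V"
    "cut_connected E (A \<union> B \<union> X)"
proof -
  obtain A where A: "A \<in> P"
    using P by fastforce
  define U where "U = \<Union>(P - {A})"
  have conA: "cut_connected E A" "A \<subseteq> V"
    using piece A by auto
  define N where "N = {x \<in> V. \<exists>a\<in>A. {a, x} \<in> E}"
  have UP: "\<Union>P = A \<union> U"
    using A by (auto simp: U_def)
  have "P - {A} \<noteq> {}"
    using P by (metis One_nat_def card.empty card_Diff_singleton A zero_less_diff less_irrefl)
  then obtain B0 where B0: "B0 \<in> P - {A}"
    by blast
  then have "B0 \<noteq> {}" "B0 \<subseteq> V"
    using piece by (auto simp: cut_connected_def)
  then obtain b0 where b0: "b0 \<in> U" "b0 \<in> V"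
    using B0 by (auto simp: U_def)
  have "\<exists>X z. finite X \<and> card X \<le> 2 \<and> X \<subseteq> V \<and> z \<in> U \<and> cut_connected E (insert z (A \<union> X))"
  proof (cases "(A \<union> N) \<inter> U = {}")
    case False
    then consider z where "z \<in> A" "z \<in> U" | z where "z \<in> N" "z \<in> U"
      by auto
    then show ?thesis
    proof cases
      case 1
      then show ?thesis
        using conA by (intro exI[of _ "{}"] exI[of _ z]) (auto simp: insert_absorb)
    next
      case 2
      then obtain a where "a \<in> A" "{a, z} \<in> E"
        by (auto simp: N_def)
      then show ?thesis
        using 2 cut_connected_insert[OF conA(1)] by (intro exI[of _ "{}"] exI[of _ z]) auto
    qed
  next
    case True
    then have "A \<union> N \<noteq> V" "A \<union> N \<noteq> {}" "A \<union> N \<subseteq> V"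
      using b0 conA by (auto simp: N_def cut_connected_def)
    then obtain x y where xy: "x \<in> A \<union> N" "y \<in> V - (A \<union> N)" "{x, y} \<in> E"
      using cut_connected_crossing[OF V] by blast
    then have "x \<notin> A"
      by (auto simp: N_def)
    then obtain a where a: "a \<in> A" "{a, x} \<in> E" "x \<in> V"
      using xy by (auto simp: N_def)
    have Axy: "cut_connected E (insert y (insert x A))"
      using cut_connected_insert[OF cut_connected_insert[OF conA(1) a(1,2)] _ xy(3)] by auto
    show ?thesis
    proof (cases "y \<in> U")
      case True
      then show ?thesis
        using Axy a by (intro exI[of _ "{x}"] exI[of _ y]) auto
    next
      case False
      then obtain z where z: "z \<in> A \<union> U" "{y, z} \<in> E"
        using dom[of y] xy UP by auto
      \<comment> \<open>A neighbour of \<open>y\<close> in \<open>A\<close> would put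
        \<open>y\<close> into \<open>N\<close>.\<close>
      then have "z \<in> U"
        using xy by (auto simp: N_def insert_commute)
      moreover have "cut_connected E (insert z (insert y (insert x A)))"
        using cut_connected_insert[OF Axy _ z(2)] by auto
      ultimately show ?thesis
        using a xy by (intro exI[of _ "{x, y}"] exI[of _ z]) (auto simp: card_insert_if insert_commute)
    qed
  qed
  then obtain X z where X: "finite X" "card X \<le> 2" "X \<subseteq> V" "z \<in> U"
    and conX: "cut_connected E (insert z (A \<union> X))"
    by blast
  from \<open>z \<in> U\<close> obtain B where B: "B \<in> P" "A \<noteq> B" "z \<in> B"
    by (auto simp: U_def)
  have "cut_connected E (insert z (A \<union> X) \<union> B)"
    using piece B by (intro cut_connected_Un conX) auto
  moreover have "insert z (A \<union> X) \<union> B = A \<union> B \<union> X"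
    using B by auto
  ultimately show ?thesis
    using that A B X by metis
qed

text \<open>Each merger by \<open>join_two_pieces\<close> adds at most two vertices and lowers the
  number of pieces, until one is left. Domination survives because the union only grows.\<close>

lemma join_pieces:
  assumes V: "cut_connected E V" and "finite V"
    and P: "finite P" "P \<noteq> {}"
    and piece: "\<And>A. A \<in> P \<Longrightarrow> cut_connected E A \<and> A \<subseteq> V"
    and dom: "\<And>v. v \<in> V - \<Union>P \<Longrightarrow> \<exists>u\<in>\<Union>P. {v, u} \<in> E"
  obtains D where "cut_connected E D" "\<Union>P \<subseteq> D" "D \<subseteq> V" "card D \<le> card (\<Union>P) + 2 * card P"
proof -
  \<comment> \<open>Induction on an upper bound for \<open>card P\<close>, since the merged set may
    coincide with another piece and the count then drops by more than one.\<close>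
  have "\<exists>D. cut_connected E D \<and> \<Union>P \<subseteq> D \<and> D \<subseteq> V \<and> card D \<le> card (\<Union>P) + 2 * m"
    if "card P \<le> Suc m" for m
    using that P piece dom
  proof (induction m arbitrary: P)
    case 0
    then obtain A where "P = {A}"
      by (metis One_nat_def card_0_eq card_1_singletonE le_Suc_eq le_zero_eq)
    then show ?case
      using 0 by (intro exI[of _ A]) auto
  next
    case (Suc m)
    show ?case
    proof (cases "card P \<le> Suc m")
      case True
      then show ?thesis
        using Suc.IH[OF True Suc.prems(2-5)] by (auto intro: le_trans)
    next
      case False
      then obtain A B X where ABX: "A \<in> P" "B \<in> P" "A \<noteq> B" "finite X" "card X \<le> 2" "X \<subseteq> V"
        "cut_connected E (A \<union> B \<union> X)"
        using join_two_pieces[OF V \<open>finite P\<close> _ Suc.prems(4,5)] by (metis Suc_lessI not_less_eq_eq not_less le_add1 plus_1_eq_Suc)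
      define Q where "Q = insert (A \<union> B \<union> X) (P - {A} - {B})"
      have UQ: "\<Union>Q = \<Union>P \<union> X"
        using ABX by (auto simp: Q_def)
      have "card (P - {A} - {B}) = card P - 2"
        using ABX Suc.prems by simp
      then have "card Q \<le> Suc m"
        using Suc.prems(1) False card_insert_le_m1[of "Suc m" "P - {A} - {B}"] by (simp add: Q_def)
      then have "\<exists>D. cut_connected E D \<and> \<Union>Q \<subseteq> D \<and> D \<subseteq> V \<and> card D \<le> card (\<Union>Q) + 2 * m"
      proof (rule Suc.IH)
        show "finite Q" "Q \<noteq> {}"
          using Suc.prems by (auto simp: Q_def)
        show "cut_connected E C \<and> C \<subseteq> V" if "C \<in> Q" for C
        proof (cases "C = A \<union> B \<union> X")
          case True
          then show ?thesis
            using ABX Suc.prems(4)[of A] Suc.prems(4)[of B] by auto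
        qed (use that Suc.prems(4) in \<open>auto simp: Q_def\<close>)
        show "\<exists>u\<in>\<Union>Q. {v, u} \<in> E" if "v \<in> V - \<Union>Q" for v
          using Suc.prems(5)[of v] that unfolding UQ by auto
      qed
      moreover have "card (\<Union>Q) \<le> card (\<Union>P) + 2"
        using card_Un_le[of "\<Union>P" X] ABX(5) by (simp add: UQ)
      ultimately obtain D where "cut_connected E D" "\<Union>P \<subseteq> D" "D \<subseteq> V" "card D \<le> card (\<Union>P) + 2 * Suc m"
        unfolding UQ by auto
      then show ?thesis
        by blast
    qed
  qed
  then show ?thesis
    using that by (meson le_SucI le_refl)
qed

text \<open>The components of \<open>Z \<union> Y\<close> that contain a vertex outside \<open>Y\<close> have at least \<open>s\<close> elements, so there
  are at most \<open>card (Z \<union> Y) / s\<close> of them; every other component lies inside \<open>Y\<close>.\<close>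

lemma connected_superset_of_dominating:
  fixes s :: real
  assumes "finite V" and V: "cut_connected E V" and "Z \<union> Y \<subseteq> V" and "s > 0"
    and large: "\<And>v. v \<in> V - Y \<Longrightarrow> s \<le> card {u \<in> Z. {v, u} \<in> E}"
  obtains D where "cut_connected E D" "Z \<union> Y \<subseteq> D" "D \<subseteq> V"
    "real (card D) \<le> card (Z \<union> Y) * (1 + 2 / s) + 2 * card Y"
proof -
  define W where "W = Z \<union> Y"
  \<comment> \<open>Adjacency in the subgraph induced on \<open>W\<close>; for
    \<open>v \<in> W\<close>, \<open>C v\<close> is the component of \<open>v\<close>.\<close>
  define r where "r = {(a, b). a \<in> W \<and> b \<in> W \<and> {a, b} \<in> E}"
  define C where "C v = r\<^sup>* `` {v}" for v
  have finW: "finite W" and "W \<subseteq> V"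
    using assms finite_subset by (auto simp: W_def)
  have con: "cut_connected E (C v)" for v
    unfolding C_def r_def by (rule cut_connected_reachable)
  have refl: "v \<in> C v" for v
    by (simp add: C_def)
  have CW: "C v \<subseteq> W" if "v \<in> W" for v
  proof
    fix u assume "u \<in> C v"
    then have "(v, u) \<in> r\<^sup>*"
      by (simp add: C_def)
    then show "u \<in> W"
      using that by (cases rule: rtranclE) (auto simp: r_def)
  qed
  have "sym r"
    by (auto simp: sym_def r_def insert_commute)
  then have "sym (r\<^sup>*)"
    by (rule sym_rtrancl)
  have disj: "C u = C v" if meet: "C u \<inter> C v \<noteq> {}" for u v
  proof -
    obtain w where "w \<in> C u" "w \<in> C v"
      using meet by blast
    then have uw: "(u, w) \<in> r\<^sup>*" and vw: "(v, w) \<in> r\<^sup>*"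
      by (simp_all add: C_def)
    have uv: "(u, v) \<in> r\<^sup>*"
      by (rule rtrancl_trans[OF uw symD[OF \<open>sym (r\<^sup>*)\<close> vw]])
    have vu: "(v, u) \<in> r\<^sup>*"
      by (rule symD[OF \<open>sym (r\<^sup>*)\<close> uv])
    show ?thesis
      unfolding C_def using rtrancl_trans[OF uv] rtrancl_trans[OF vu] by (intro equalityI subsetI) simp_all
  qed
  have finC: "finite (C v)" if "v \<in> W" for v
    using CW[OF that] finW by (rule finite_subset)
  \<comment> \<open>The component contains all neighbours of \<open>v\<close> in
    \<open>Z\<close>.\<close>
  have big: "s \<le> card (C v)" if "v \<in> W - Y" for v
  proof -
    have "{u \<in> Z. {v, u} \<in> E} \<subseteq> C v"
      using that by (auto simp: C_def r_def W_def)
    then have "card {u \<in> Z. {v, u} \<in> E} \<le> card (C v)"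
      using CW[of v] that finW by (meson DiffD1 card_mono finite_subset)
    moreover have "s \<le> card {u \<in> Z. {v, u} \<in> E}"
      using large that \<open>W \<subseteq> V\<close> by auto
    ultimately show ?thesis
      by linarith
  qed
  define P where "P = C ` W"
  have UP: "\<Union>P = W"
    using CW refl by (auto simp: P_def)
  have finP: "finite P"
    using finW by (simp add: P_def)
  have "W \<noteq> {}"
  proof
    assume "W = {}"
    moreover obtain v where "v \<in> V"
      using V by (auto simp: cut_connected_def)
    ultimately show False
      using large[of v] \<open>s > 0\<close> by (auto simp: W_def)
  qed
  \<comment> \<open>Distinct components are disjoint, so the sizes of the large ones add up to at
    most \<open>card W\<close>.\<close>
  have "real (card (C ` (W - Y))) * s = (\<Sum>A\<in>C ` (W - Y). s)"
    by simp
  also have "\<dots> \<le> (\<Sum>A\<in>C ` (W - Y). real (card A))"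
    using big by (intro sum_mono) auto
  also have "\<dots> = real (card (\<Union>(C ` (W - Y))))"
    using disj finC by (subst card_Union_disjoint) (auto simp: pairwise_def disjnt_def)
  also have "\<dots> \<le> real (card W)"
    using CW finW by (intro of_nat_mono card_mono) auto
  finally have "card (C ` (W - Y)) \<le> card W / s"
    using \<open>s > 0\<close> by (simp add: field_simps)
  moreover have "card (C ` (W \<inter> Y)) \<le> card Y"
    using assms finite_subset[of Y V] by (intro card_image_le[THEN order_trans] card_mono) auto
  moreover have "card P \<le> card (C ` (W - Y)) + card (C ` (W \<inter> Y))"
  proof -
    have "P = C ` (W - Y) \<union> C ` (W \<inter> Y)"
      unfolding P_def by blast
    then show ?thesis
      by (simp add: card_Un_le)
  qed
  ultimately have cardP: "card P \<le> card W / s + card Y"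
    by linarith
  obtain D where D: "cut_connected E D" "\<Union>P \<subseteq> D" "D \<subseteq> V"
    "card D \<le> card (\<Union>P) + 2 * card P"
  proof (rule join_pieces[OF V \<open>finite V\<close> finP])
    show "P \<noteq> {}"
      using \<open>W \<noteq> {}\<close> by (simp add: P_def)
    show "cut_connected E A \<and> A \<subseteq> V" if "A \<in> P" for A
      using that con CW \<open>W \<subseteq> V\<close> by (fastforce simp: P_def)
    show "\<exists>u\<in>\<Union>P. {v, u} \<in> E" if "v \<in> V - \<Union>P" for v
    proof -
      have "s \<le> card {u \<in> Z. {v, u} \<in> E}"
        using that unfolding UP by (intro large) (auto simp: W_def)
      then have "{u \<in> Z. {v, u} \<in> E} \<noteq> {}"
        using \<open>s > 0\<close> by (metis card.empty not_less of_nat_0)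
      then show ?thesis
        unfolding UP by (auto simp: W_def)
    qed
  qed
  have "real (card D) \<le> real (card W) + 2 * card P"
    using D(4) unfolding UP by linarith
  also have "\<dots> \<le> card W + 2 * (card W / s + card Y)"
    using cardP by simp
  finally show ?thesis
    using that[of D] D unfolding UP by (simp add: W_def algebra_simps)
qed

subsection \<open>Rainbow colorings from dominating sets\<close>

text \<open>A spanning tree of \<open>D\<close> gets pairwise different colors, and every outside vertex has edges of
  \<open>k\<close> further colors into \<open>D\<close>; a set of \<open>k\<close> vertices is attached to the tree by edges of different
  colors.\<close>

lemma rainbow_index_le_cut_connected:
  assumes G: "simple_graph V E" and "D \<subseteq> V" and D: "cut_connected E D"
    and nbrs: "\<And>v. v \<in> V - D \<Longrightarrow> k \<le> card {u \<in> D. {v, u} \<in> E}"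
  shows "rainbow_index k V E \<le> card D + k"
proof -
  have "finite V" and EV: "\<And>e. e \<in> E \<Longrightarrow> e \<subseteq> V"
    using G by (auto simp: simple_graph_def)
  then have "finite D"
    using \<open>D \<subseteq> V\<close> finite_subset by blast
  obtain F where F: "graph_tree D F" "F \<subseteq> E" "card F < card D"
    using cut_connected_spanning_tree[OF \<open>finite D\<close> D] by blast
  have FD: "e \<subseteq> D" if "e \<in> F" for e
    using F(1) that by (auto simp: graph_tree_def simple_graph_def)
  have "finite E"
    using EV \<open>finite V\<close> by (meson PowI finite_Pow_iff finite_subset subsetI)
  then have "finite F"
    using F(2) finite_subset by blast
  then obtain g where g: "bij_betw g F {0..<card F}"
    using ex_bij_betw_finite_nat by blast
  \<comment> \<open>\<open>d v\<close> will list \<open>k\<close> different neighbours of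
    \<open>v\<close> in \<open>D\<close>, indexed by the colors below \<open>k\<close>.\<close>
  have "\<exists>f. inj_on f {..<k} \<and> f ` {..<k} \<subseteq> {u \<in> D. {v, u} \<in> E}" if "v \<in> V - D" for v
  proof -
    obtain T where T: "T \<subseteq> {u \<in> D. {v, u} \<in> E}" "card T = k" "finite T"
      using nbrs[OF \<open>v \<in> V - D\<close>] by (rule obtain_subset_with_card_n)
    obtain f where "bij_betw f {0..<card T} T"
      using ex_bij_betw_nat_finite \<open>finite T\<close> by blast
    then show ?thesis
      using T by (intro exI[of _ f]) (auto simp: bij_betw_def atLeast0LessThan)
  qed
  then obtain d where d_inj: "\<And>v. v \<in> V - D \<Longrightarrow> inj_on (d v) {..<k}"
    and d: "\<And>v i. v \<in> V - D \<Longrightarrow> i < k \<Longrightarrow> d v i \<in> D \<and> {v, d v i} \<in> E"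
    by (metis (no_types, lifting) image_subset_iff lessThan_iff mem_Collect_eq)
  define I where "I = (V - D) \<times> {..<k}"
  define link where "link = (\<lambda>(v, i). {v, d v i})"
  \<comment> \<open>The only end of a link outside \<open>D\<close> is \<open>v\<close>; injectivity
    of \<open>d v\<close> then determines \<open>i\<close>.\<close>
  have inj: "inj_on link I"
  proof (rule inj_onI)
    fix x y assume xy: "x \<in> I" "y \<in> I" "link x = link y"
    obtain v i w j where eq: "x = (v, i)" "y = (w, j)"
      by (metis surj_pair)
    then have vw: "v \<in> V - D" "w \<in> V - D" "i < k" "j < k" "{v, d v i} = {w, d w j}"
      using xy by (auto simp: I_def link_def)
    then have "v = w" "d v i = d v j"
      using d[of v i] d[of w j] by (auto simp: doubleton_eq_iff)
    then show "x = y"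
      using d_inj[of v] vw eq by (auto simp: inj_on_def)
  qed
  \<comment> \<open>Tree edges get different colors from \<open>k\<close> upwards, the link from
    \<open>v\<close> to \<open>d v i\<close> gets color \<open>i < k\<close>, and all other edges
    the default 0.\<close>
  define c where "c e = (if e \<in> F then k + g e
    else if e \<in> link ` I then snd (inv_into I link e) else 0)" for e
  have cF: "c e = k + g e" if "e \<in> F" for e
    using that by (simp add: c_def)
  have c_link: "c {v, d v i} = i" if "v \<in> V - D" "i < k" for v i
  proof -
    have "(v, i) \<in> I" "{v, d v i} = link (v, i)" "{v, d v i} \<notin> F"
      using that FD by (auto simp: I_def link_def)
    then show ?thesis
      by (simp add: c_def inv_into_f_f[OF inj] del: insert_iff)
  qed
  have "c ` E \<subseteq> insert 0 {..<k + card F}"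
  proof
    fix m assume "m \<in> c ` E"
    then obtain e where e: "m = c e" "e \<in> E"
      by auto
    consider "e \<in> F" | "e \<in> link ` I" | "c e = 0"
      by (metis c_def)
    then show "m \<in> insert 0 {..<k + card F}"
    proof cases
      case 1
      then have "g e < card F"
        using bij_betwE[OF g] by auto
      then show ?thesis
        using cF[OF 1] e by simp
    next
      case 2
      then obtain v i where "v \<in> V - D" "i < k" "e = {v, d v i}"
        by (auto simp: I_def link_def)
      then show ?thesis
        using c_link e by simp
    qed (use e in simp)
  qed
  then have "card (c ` E) \<le> card (insert 0 {..<k + card F})"
    by (intro card_mono) auto
  \<comment> \<open>One color is allowed for the default 0; \<open>card F < card D\<close> pays for
    it.\<close>
  also have "\<dots> \<le> card D + k"
    using F(3) card_insert_le_m1[of "Suc (k + card F)" "{..<k + card F}" 0] by simp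
  finally have "card (c ` E) \<le> card D + k" .
  moreover have "k_rainbow_coloring k V E c"
    unfolding k_rainbow_coloring_def
  proof (intro allI impI)
    fix S assume S: "S \<subseteq> V \<and> card S = k"
    then have "finite S"
      using \<open>finite V\<close> finite_subset by blast
    \<comment> \<open>Numbering \<open>S\<close> gives its vertices outside \<open>D\<close>
      attaching edges of different colors below \<open>k\<close>.\<close>
    then obtain h where h: "bij_betw h S {0..<k}"
      using ex_bij_betw_finite_nat S by blast
    define T where "T = S - D"
    define f where "f v = d v (h v)" for v
    have hk: "h v < k" if "v \<in> T" for v
      using bij_betwE[OF h] that by (auto simp: T_def)
    have f: "f v \<in> D" "{v, f v} \<in> E" "c {v, f v} = h v" if "v \<in> T" for v
      using d[of v "h v"] c_link[of v "h v"] hk[OF that] that S by (auto simp: f_def T_def)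
    have "graph_tree (D \<union> T) (F \<union> (\<lambda>v. {v, f v}) ` T)"
      using F(1) f \<open>finite S\<close> by (intro graph_tree_add_leaves) (auto simp: T_def)
    moreover have "inj_on c (F \<union> (\<lambda>v. {v, f v}) ` T)"
    proof (subst inj_on_Un, intro conjI)
      show "inj_on c F"
        using g cF by (auto simp: inj_on_def bij_betw_def)
      have "inj_on h T"
        using h by (auto simp: T_def bij_betw_def inj_on_def)
      then show "inj_on c ((\<lambda>v. {v, f v}) ` T)"
        using f(3) by (auto simp: inj_on_def)
      have "c ` (F - (\<lambda>v. {v, f v}) ` T) \<subseteq> {k..}"
        using cF by auto
      moreover have "c ` ((\<lambda>v. {v, f v}) ` T - F) \<subseteq> {..<k}"
        using f(3) hk by auto
      moreover have "{k..} \<inter> {..<k} = {}"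
        by auto
      ultimately show "c ` (F - (\<lambda>v. {v, f v}) ` T) \<inter> c ` ((\<lambda>v. {v, f v}) ` T - F) = {}"
        by blast
    qed
    moreover have "D \<union> T \<subseteq> V" "F \<union> (\<lambda>v. {v, f v}) ` T \<subseteq> E" "S \<subseteq> D \<union> T"
      using S f F \<open>D \<subseteq> V\<close> by (auto simp: T_def)
    ultimately show "\<exists>W F. rainbow_tree V E c W F \<and> S \<subseteq> W"
      unfolding rainbow_tree_def by blast
  qed
  then have "rainbow_index k V E \<le> card (c ` E)"
    unfolding rainbow_index_def by (intro Least_le) auto
  ultimately show ?thesis
    by linarith
qed

subsection \<open>Random vertex sets\<close>

text \<open>For \<open>0 \<le> p \<le> 1\<close>, \<open>w X\<close> is the probability that
  independent choices with probability \<open>p\<close> produce \<open>X\<close>. Total mass,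
  expected size and the generating function of the number of chosen elements of \<open>N\<close> all
  come from expanding products over \<open>V\<close> by \<open>prod_add\<close>.\<close>

lemma random_subset_weights:
  fixes V :: "'a set" and p t :: real and w :: "'a set \<Rightarrow> real"
  assumes "finite V"
  defines "w \<equiv> \<lambda>X. p ^ card X * (1 - p) ^ card (V - X)"
  shows "(\<Sum>X\<in>Pow V. w X) = 1"
    and "(\<Sum>X\<in>Pow V. w X * card X) = card V * p"
    and "N \<subseteq> V \<Longrightarrow> (\<Sum>X\<in>Pow V. w X * t ^ card (X \<inter> N)) = (1 - p + p * t) ^ card N"
proof -
  have "(\<Sum>X\<in>Pow V. w X) = (\<Prod>x\<in>V. p + (1 - p))"
    using assms by (subst prod_add) (auto simp: w_def)
  then show "(\<Sum>X\<in>Pow V. w X) = 1"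
    by simp
next
  have single: "(\<Sum>X\<in>Pow V. w X * of_bool (v \<in> X)) = p" if "v \<in> V" for v
  proof -
    \<comment> \<open>The factor 0 at \<open>v\<close> in the unchosen part removes exactly the sets
      missing \<open>v\<close>.\<close>
    have "w X * of_bool (v \<in> X) = (\<Prod>x\<in>X. p) * (\<Prod>x\<in>V - X. if x = v then 0 else 1 - p)"
      if "X \<subseteq> V" for X
    proof (cases "v \<in> X")
      case True
      then have "(\<Prod>x\<in>V - X. if x = v then 0 else 1 - p) = (\<Prod>x\<in>V - X. 1 - p)"
        by (intro prod.cong) auto
      then show ?thesis
        using True by (simp add: w_def)
    next
      case False
      then have "(\<Prod>x\<in>V - X. if x = v then 0 else 1 - p) = 0"
        using \<open>v \<in> V\<close> \<open>finite V\<close> by (intro prod_zero) auto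
      then show ?thesis
        using False by simp
    qed
    then have "(\<Sum>X\<in>Pow V. w X * of_bool (v \<in> X))
      = (\<Sum>X\<in>Pow V. (\<Prod>x\<in>X. p) * (\<Prod>x\<in>V - X. if x = v then 0 else 1 - p))"
      by (intro sum.cong) auto
    also have "\<dots> = (\<Prod>x\<in>V. p + (if x = v then 0 else 1 - p))"
      by (rule prod_add[symmetric]) fact
    also have "\<dots> = (\<Prod>x\<in>V. if x = v then p else 1)"
      by (intro prod.cong) auto
    also have "\<dots> = p"
      using that assms by simp
    finally show ?thesis .
  qed
  have card: "real (card X) = (\<Sum>v\<in>V. of_bool (v \<in> X))" if "X \<subseteq> V" for X
    using that assms by (simp add: Int_absorb1 flip: sum.inter_filter)
  have "(\<Sum>X\<in>Pow V. w X * card X) = (\<Sum>X\<in>Pow V. \<Sum>v\<in>V. w X * of_bool (v \<in> X))"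
    by (intro sum.cong) (simp_all only: card sum_distrib_left Pow_iff)
  also have "\<dots> = (\<Sum>v\<in>V. \<Sum>X\<in>Pow V. w X * of_bool (v \<in> X))"
    by (rule sum.swap)
  also have "\<dots> = card V * p"
    using single by simp
  finally show "(\<Sum>X\<in>Pow V. w X * card X) = card V * p" .
next
  assume "N \<subseteq> V"
  \<comment> \<open>Every chosen element of \<open>N\<close> carries an extra factor
    \<open>t\<close>, so the sum again expands a product over \<open>V\<close>.\<close>
  have "w X * t ^ card (X \<inter> N) = (\<Prod>x\<in>X. if x \<in> N then p * t else p) * (\<Prod>x\<in>V - X. 1 - p)"
    if "X \<subseteq> V" for X
  proof -
    have "finite X"
      using that assms finite_subset by blast
    have "(\<Prod>x\<in>X. if x \<in> N then p * t else p) = (\<Prod>x\<in>X. p * (if x \<in> N then t else 1))"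
      by (intro prod.cong) auto
    also have "\<dots> = p ^ card X * t ^ card (X \<inter> N)"
      using \<open>finite X\<close> by (simp add: prod.distrib prod.inter_restrict[symmetric])
    finally show ?thesis
      by (simp add: w_def)
  qed
  then have "(\<Sum>X\<in>Pow V. w X * t ^ card (X \<inter> N))
    = (\<Sum>X\<in>Pow V. (\<Prod>x\<in>X. if x \<in> N then p * t else p) * (\<Prod>x\<in>V - X. 1 - p))"
    by (intro sum.cong) auto
  also have "\<dots> = (\<Prod>x\<in>V. (if x \<in> N then p * t else p) + (1 - p))"
    by (rule prod_add[symmetric]) fact
  also have "\<dots> = (\<Prod>x\<in>V. if x \<in> N then 1 - p + p * t else 1)"
    by (intro prod.cong) auto
  also have "\<dots> = (1 - p + p * t) ^ card N"
    using assms \<open>N \<subseteq> V\<close> by (simp add: prod.inter_restrict[symmetric] Int_absorb1)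
  finally show "(\<Sum>X\<in>Pow V. w X * t ^ card (X \<inter> N)) = (1 - p + p * t) ^ card N" .
qed

text \<open>First-moment argument: the average cost under \<open>w\<close> is at most the right-hand
  side, so some set does not exceed it. The base of the power lies in [0, 1], so replacing
  \<open>card (N v)\<close> by \<open>d\<close> can only raise the bound.\<close>

lemma subset_below_expected_cost:
  fixes p t a b :: real
  assumes "finite V" and p: "0 \<le> p" "p \<le> 1" and t: "0 \<le> t" "t \<le> 1" and "0 \<le> b"
    and N: "\<And>v. v \<in> V \<Longrightarrow> N v \<subseteq> V \<and> d \<le> card (N v)"
  obtains X where "X \<subseteq> V"
    "a * card X + b * (\<Sum>v\<in>V. t ^ card (X \<inter> N v)) \<le> card V * (a * p + b * (1 - p + p * t) ^ d)"
proof -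
  define w where "w X = p ^ card X * (1 - p) ^ card (V - X)" for X
  define K where "K = card V * (a * p + b * (1 - p + p * t) ^ d)"
  define cost where "cost X = a * card X + b * (\<Sum>v\<in>V. t ^ card (X \<inter> N v))" for X
  have w0: "w X \<ge> 0" for X
    using p by (simp add: w_def)
  note w = random_subset_weights[OF \<open>finite V\<close>, where p = p, folded w_def]
  have base: "0 \<le> 1 - p + p * t" "1 - p + p * t \<le> 1"
    using p t mult_left_le[of t p] by auto
  have "(\<Sum>X\<in>Pow V. \<Sum>v\<in>V. w X * t ^ card (X \<inter> N v))
    = (\<Sum>v\<in>V. \<Sum>X\<in>Pow V. w X * t ^ card (X \<inter> N v))"
    by (rule sum.swap)
  also have "\<dots> = (\<Sum>v\<in>V. (1 - p + p * t) ^ card (N v))"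
    using N by (intro sum.cong refl w(3)) auto
  also have "\<dots> \<le> (\<Sum>v\<in>V. (1 - p + p * t) ^ d)"
    using N base by (intro sum_mono power_decreasing) auto
  finally have "b * (\<Sum>X\<in>Pow V. \<Sum>v\<in>V. w X * t ^ card (X \<inter> N v)) \<le> b * (card V * (1 - p + p * t) ^ d)"
    using \<open>0 \<le> b\<close> by (intro mult_left_mono) simp_all
  moreover have "(\<Sum>X\<in>Pow V. w X * cost X)
    = a * (\<Sum>X\<in>Pow V. w X * card X) + b * (\<Sum>X\<in>Pow V. \<Sum>v\<in>V. w X * t ^ card (X \<inter> N v))"
    by (simp add: cost_def distrib_left sum.distrib sum_distrib_left mult_ac)
  ultimately have le: "(\<Sum>X\<in>Pow V. w X * cost X) \<le> K"
    unfolding K_def w(2) by (simp add: distrib_left mult_ac)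
  have "\<exists>X\<in>Pow V. cost X \<le> K"
  proof (rule ccontr)
    assume no: "\<not> ?thesis"
    have gt: "K < cost X" if "X \<in> Pow V" for X
      using no that by (meson not_le)
    \<comment> \<open>A set of positive weight makes the comparison of averages strict.\<close>
    have "\<exists>X\<in>Pow V. w X \<noteq> 0"
      using w(1) by (metis sum.neutral zero_neq_one)
    then obtain X where X: "X \<in> Pow V" "w X > 0"
      using w0 by (metis less_eq_real_def)
    have "(\<Sum>X\<in>Pow V. w X * K) < (\<Sum>X\<in>Pow V. w X * cost X)"
    proof (rule sum_strict_mono_ex1)
      show "\<forall>X\<in>Pow V. w X * K \<le> w X * cost X"
        using gt w0 by (meson less_imp_le mult_left_mono)
      show "\<exists>X\<in>Pow V. w X * K < w X * cost X"
        using gt X mult_strict_left_mono by blast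
    qed (use \<open>finite V\<close> in simp)
    then show False
      using le w(1) by (simp flip: sum_distrib_right)
  qed
  then show ?thesis
    using that by (auto simp: cost_def K_def)
qed

text \<open>The vertices with fewer than \<open>s\<close> neighbours in a random set \<open>X\<close> are counted by bounding
  their indicator by \<open>t powr (m - s)\<close>, where \<open>m\<close> is the number of neighbours in \<open>X\<close>.\<close>

lemma connected_dominating_set:
  fixes p s t :: real
  assumes "finite V" and V: "cut_connected E V"
    and deg: "\<And>v. v \<in> V \<Longrightarrow> {u. {v, u} \<in> E} \<subseteq> V \<and> \<delta> \<le> card {u. {v, u} \<in> E}"
    and p: "0 \<le> p" "p \<le> 1" and t: "0 < t" "t \<le> 1" and "2 \<le> s"
  obtains D where "cut_connected E D" "D \<subseteq> V"
    "\<And>v. v \<in> V - D \<Longrightarrow> s \<le> card {u \<in> D. {v, u} \<in> E}"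
    "card D \<le> card V * (p * (1 + 2 / s) + 4 * (t powr (- s) * exp (- p * (1 - t) * \<delta>)))"
proof -
  define N where "N v = {u. {v, u} \<in> E}" for v
  \<comment> \<open>The factors reflect what a vertex costs in \<open>D\<close>:
    \<open>1 + 2 / s\<close> for one of \<open>X\<close>, and two more for one of \<open>Y\<close>,
    which is at most 4 since \<open>s \<ge> 2\<close>.\<close>
  obtain X where "X \<subseteq> V" and X: "(1 + 2 / s) * card X + 4 * t powr (- s) * (\<Sum>v\<in>V. t ^ card (X \<inter> N v))
    \<le> card V * ((1 + 2 / s) * p + 4 * t powr (- s) * (1 - p + p * t) ^ \<delta>)"
    using subset_below_expected_cost[of V p t "4 * t powr (- s)" N \<delta> "1 + 2 / s"] assms
    unfolding N_def by auto
  have XN: "{u \<in> X. {v, u} \<in> E} = X \<inter> N v" for v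
    by (auto simp: N_def)
  define Y where "Y = {v \<in> V. card (X \<inter> N v) < s}"
  \<comment> \<open>The exponent \<open>card (X \<inter> N v) - s\<close> is negative on
    \<open>Y\<close>, and \<open>t \<le> 1\<close>.\<close>
  have "1 \<le> t powr (- s) * t ^ card (X \<inter> N v)" if "v \<in> Y" for v
  proof -
    have "t powr (- s) * t ^ card (X \<inter> N v) = t powr (card (X \<inter> N v) - s)"
      using t by (simp add: powr_diff powr_minus powr_realpow field_simps)
    moreover have "1 \<le> t powr (card (X \<inter> N v) - s)"
      using t that by (simp add: Y_def powr_def mult_nonpos_nonpos)
    ultimately show ?thesis
      by simp
  qed
  then have "real (card Y) \<le> (\<Sum>v\<in>Y. t powr (- s) * t ^ card (X \<inter> N v))"
    using sum_bounded_below[of Y 1 "\<lambda>v. t powr (- s) * t ^ card (X \<inter> N v)"] by simp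
  also have "\<dots> \<le> (\<Sum>v\<in>V. t powr (- s) * t ^ card (X \<inter> N v))"
    using \<open>finite V\<close> t by (intro sum_mono2) (auto simp: Y_def)
  finally have Y: "real (card Y) \<le> t powr (- s) * (\<Sum>v\<in>V. t ^ card (X \<inter> N v))"
    by (simp add: sum_distrib_left)
  obtain D where D: "cut_connected E D" "X \<union> Y \<subseteq> D" "D \<subseteq> V"
    "real (card D) \<le> card (X \<union> Y) * (1 + 2 / s) + 2 * card Y"
  proof (rule connected_superset_of_dominating[OF \<open>finite V\<close> V])
    show "X \<union> Y \<subseteq> V" "0 < s"
      using \<open>X \<subseteq> V\<close> \<open>2 \<le> s\<close> by (auto simp: Y_def)
    show "s \<le> card {u \<in> X. {v, u} \<in> E}" if "v \<in> V - Y" for v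
      using that unfolding XN by (auto simp: Y_def)
  qed
  have nbrs: "s \<le> card {u \<in> D. {v, u} \<in> E}" if "v \<in> V - D" for v
  proof -
    have "s \<le> card {u \<in> X. {v, u} \<in> E}"
      using that D(2) unfolding XN by (auto simp: Y_def)
    also have "card {u \<in> X. {v, u} \<in> E} \<le> card {u \<in> D. {v, u} \<in> E}"
      using D \<open>finite V\<close> by (intro card_mono) (auto intro: finite_subset)
    finally show ?thesis
      by simp
  qed
  have s: "2 / s \<le> 1"
    using \<open>2 \<le> s\<close> by simp
  have "0 \<le> p * t"
    using p t by simp
  \<comment> \<open>\<open>1 - x \<le> exp (- x)\<close> at \<open>x = p * (1 - t)\<close>.\<close>
  then have "(1 - p + p * t) ^ \<delta> \<le> exp (- p * (1 - t)) ^ \<delta>"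
    using exp_ge_add_one_self[of "- p * (1 - t)"] p
    by (intro power_mono) (auto simp: algebra_simps)
  also have "\<dots> = exp (- p * (1 - t) * \<delta>)"
    by (simp add: exp_of_nat_mult[symmetric] mult_ac)
  finally have tail: "(1 - p + p * t) ^ \<delta> \<le> exp (- p * (1 - t) * \<delta>)" .
  have "real (card (X \<union> Y)) \<le> real (card X) + card Y"
    using card_Un_le[of X Y] by linarith
  then have "card (X \<union> Y) * (1 + 2 / s) \<le> (real (card X) + card Y) * (1 + 2 / s)"
    using \<open>2 \<le> s\<close> by (intro mult_right_mono) auto
  also have "\<dots> \<le> (1 + 2 / s) * card X + 2 * card Y"
    using mult_left_mono[OF s, of "real (card Y)"] by (simp add: algebra_simps)
  finally have "real (card D) \<le> (1 + 2 / s) * card X + 4 * card Y"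
    using D(4) by linarith
  also have "\<dots> \<le> card V * ((1 + 2 / s) * p + 4 * t powr (- s) * (1 - p + p * t) ^ \<delta>)"
    using X Y by linarith
  also have "\<dots> \<le> card V * (p * (1 + 2 / s) + 4 * (t powr (- s) * exp (- p * (1 - t) * \<delta>)))"
    using mult_left_mono[OF tail, of "t powr (- s)"] by (intro mult_left_mono) (auto simp: mult_ac)
  finally show ?thesis
    using that D nbrs by blast
qed

subsection \<open>The asymptotic bound\<close>

text \<open>Degrees count edges, the construction counts neighbours: sending \<open>u\<close> to
  \<open>{v, u}\<close> covers all edges at \<open>v\<close>.\<close>

lemma min_degree_neighbours:
  assumes G: "simple_graph V E" and "v \<in> V"
  shows "{u. {v, u} \<in> E} \<subseteq> V - {v}" "min_degree V E \<le> card {u. {v, u} \<in> E}"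
proof -
  have E: "e \<subseteq> V \<and> card e = 2" if "e \<in> E" for e
    using G that by (simp add: simple_graph_def)
  show "{u. {v, u} \<in> E} \<subseteq> V - {v}"
  proof
    fix u assume "u \<in> {u. {v, u} \<in> E}"
    then show "u \<in> V - {v}"
      using E[of "{v, u}"] by (cases "u = v") auto
  qed
  then have fin: "finite {u. {v, u} \<in> E}"
    using G finite_subset unfolding simple_graph_def by blast
  have "{e \<in> E. v \<in> e} \<subseteq> (\<lambda>u. {v, u}) ` {u. {v, u} \<in> E}"
  proof
    fix e assume e: "e \<in> {e \<in> E. v \<in> e}"
    then obtain x y where "e = {x, y}"
      using E[of e] by (auto simp: card_2_iff)
    then show "e \<in> (\<lambda>u. {v, u}) ` {u. {v, u} \<in> E}"
      using e by (auto simp: insert_commute)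
  qed
  then have "vertex_degree E v \<le> card {u. {v, u} \<in> E}"
    unfolding vertex_degree_def using fin by (meson card_image_le card_mono finite_imageI le_trans)
  moreover have "min_degree V E \<le> vertex_degree E v"
    using G \<open>v \<in> V\<close> unfolding min_degree_def simple_graph_def by auto
  ultimately show "min_degree V E \<le> card {u. {v, u} \<in> E}"
    by simp
qed

text \<open>The summand \<open>s / \<delta>\<close> absorbs the additive \<open>k\<close>, since
  \<open>card V \<ge> \<delta>\<close> and \<open>k \<le> s\<close>. A value of \<open>p\<close>
  above 1 is no probability, but then the bound exceeds \<open>card V\<close> and
  \<open>D = V\<close> serves.\<close>

lemma rainbow_index_bound:
  fixes s t p :: real
  assumes G: "simple_graph V E" and con: "graph_connected V E" and \<delta>: "\<delta> \<le> min_degree V E" "0 < \<delta>"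
    and p: "0 \<le> p" and t: "0 < t" "t \<le> 1" and s: "2 \<le> s" "real k \<le> s"
  shows "rainbow_index k V E
    \<le> card V * (p * (1 + 2 / s) + 4 * (t powr (- s) * exp (- p * (1 - t) * \<delta>)) + s / \<delta>)"
proof -
  have "finite V"
    using G by (simp add: simple_graph_def)
  have V: "cut_connected E V"
    using con by (rule graph_connected_imp_cut_connected)
  obtain v where "v \<in> V"
    using V by (auto simp: cut_connected_def)
  have nbrs: "{u. {v, u} \<in> E} \<subseteq> V \<and> \<delta> \<le> card {u. {v, u} \<in> E}" if "v \<in> V" for v
    using min_degree_neighbours[OF G that] \<delta> by auto
  have "\<delta> \<le> card V"
    using nbrs[OF \<open>v \<in> V\<close>] card_mono[OF \<open>finite V\<close>] le_trans by blast
  then have "k \<le> card V * (s / \<delta>)"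
    using s \<delta> mult_mono[of "real \<delta>" "card V" "real k" s] by (simp add: field_simps)
  moreover obtain D where D: "cut_connected E D" "D \<subseteq> V" "\<And>v. v \<in> V - D \<Longrightarrow> s \<le> card {u \<in> D. {v, u} \<in> E}"
    "card D \<le> card V * (p * (1 + 2 / s) + 4 * (t powr (- s) * exp (- p * (1 - t) * \<delta>)))"
  proof (cases "p \<le> 1")
    case True
    show ?thesis
      using connected_dominating_set[OF \<open>finite V\<close> V nbrs p True t s(1)] that by blast
  next
    case False
    then have "1 * 1 \<le> p * (1 + 2 / s)"
      using s by (intro mult_mono) auto
    then have "real (card V) * 1 \<le> card V * (p * (1 + 2 / s) + 4 * (t powr (- s) * exp (- p * (1 - t) * \<delta>)))"
      by (intro mult_left_mono) (auto intro: add_increasing2)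
    then show ?thesis
      using that[of V] V by simp
  qed
  moreover have "rainbow_index k V E \<le> card D + k"
  proof (rule rainbow_index_le_cut_connected[OF G D(2,1)])
    show "k \<le> card {u \<in> D. {v, u} \<in> E}" if "v \<in> V - D" for v
      using D(3)[OF that] s(2) by linarith
  qed
  ultimately show ?thesis
    by (simp add: distrib_left)
qed

theorem theorem3p14:
  shows "\<exists>\<epsilon> :: nat \<Rightarrow> real. \<epsilon> \<longlonglongrightarrow> 0 \<and>
    (\<forall>(k::nat) (\<delta>::nat) (V :: 'a set) (E :: 'a set set).
       0 < k \<and> 0 < \<delta> \<and> 2 \<le> k \<and> real k < sqrt (ln (real \<delta>)) \<and>
       simple_graph V E \<and> graph_connected V E \<and>
       k \<le> card V \<and> \<delta> \<le> min_degree V E \<longrightarrow>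
       real (rainbow_index k V E) \<le>
         real (card V) * (ln (real \<delta>) / real \<delta>) * (1 + \<epsilon> \<delta>))"
proof -
  \<comment> \<open>\<open>rainbow_index_bound\<close> with \<open>s = sqrt (ln x)\<close>,
    \<open>t = 1 / ln x\<close> and \<open>p = (ln x + s * ln (ln x)) / x\<close>. The surplus in
    \<open>p\<close> offsets \<open>t powr (- s) = exp (s * ln (ln x))\<close>, so the summand with
    factor 4 is O(1 / x), against a main term of order \<open>ln x / x\<close>.\<close>
  define bound :: "real \<Rightarrow> real" where
    "bound x = (ln x + sqrt (ln x) * ln (ln x)) / x * (1 + 2 / sqrt (ln x))
      + 4 * ((1 / ln x) powr (- sqrt (ln x))
          * exp (- ((ln x + sqrt (ln x) * ln (ln x)) / x) * (1 - 1 / ln x) * x))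
      + sqrt (ln x) / x" for x
  \<comment> \<open>Solved from \<open>bound \<delta> = ln \<delta> / \<delta> * (1 + \<epsilon>
    \<delta>)\<close>.\<close>
  define \<epsilon> :: "nat \<Rightarrow> real" where "\<epsilon> \<delta> = bound \<delta> * \<delta> / ln \<delta> - 1" for \<delta>
  have "((\<lambda>x. bound x * x / ln x - 1) \<longlongrightarrow> 0) at_top"
    unfolding bound_def by real_asymp
  then have "\<epsilon> \<longlonglongrightarrow> 0"
    unfolding \<epsilon>_def by (rule filterlim_compose[OF _ filterlim_real_sequentially])
  moreover have "rainbow_index k V E \<le> card V * (ln \<delta> / \<delta>) * (1 + \<epsilon> \<delta>)"
    if "0 < \<delta>" "2 \<le> k" and k: "real k < sqrt (ln \<delta>)"
      and G: "simple_graph V E" "graph_connected V E" and deg: "\<delta> \<le> min_degree V E"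
    for k \<delta> and V :: "'a set" and E
  proof -
    \<comment> \<open>From \<open>k \<ge> 2\<close> follow \<open>s \<ge> 2\<close> and
      \<open>ln \<delta> > 4\<close>, hence \<open>t \<le> 1\<close> and
      \<open>ln (ln \<delta>) \<ge> 0\<close>, so that \<open>p \<ge> 0\<close>.\<close>
    have s: "2 < sqrt (ln \<delta>)"
      using that by linarith
    then have "2 ^ 2 < sqrt (ln \<delta>) ^ 2"
      by (intro power_strict_mono) auto
    moreover have "0 < ln \<delta>"
      using s real_sqrt_gt_0_iff[of "ln \<delta>"] by linarith
    ultimately have L: "4 < ln \<delta>"
      by simp
    then have "0 \<le> ln (ln \<delta>)"
      by (intro ln_ge_zero) simp
    then have "0 \<le> (ln \<delta> + sqrt (ln \<delta>) * ln (ln \<delta>)) / \<delta>"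
      using L by simp
    then have "rainbow_index k V E \<le> card V * bound \<delta>"
      unfolding bound_def using s L k by (intro rainbow_index_bound[OF G deg \<open>0 < \<delta>\<close>]) auto
    also have "bound \<delta> = ln \<delta> / \<delta> * (1 + \<epsilon> \<delta>)"
      using L \<open>0 < \<delta>\<close> by (cases "\<delta> = 1") (simp_all add: \<epsilon>_def)
    finally show ?thesis
      by (simp add: mult.assoc)
  qed
  ultimately show ?thesis
    by blast
qed

end
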